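(* Let $R$ be a ring. Then the following are equivalent. (i) $R$ is a mid ring. (ii) For all $a,b\in R$, if $ab=0$, then there exists $n\geq 1$ such that $\mathrm{Ann}(a)+\mathrm{Ann}(b^{n})=R$. (iii) $R_{\mathfrak{p}}$ is a primary ring for all prime ideals $\mathfrak{p}$ of $R$. (iv) $R_{\mathfrak{m}}$ is a primary ring for all maximal ideals $\mathfrak{m}$ of $R$. (v) $\mathrm{Ker}\,\pi_{\mathfrak{p}}$ is a pure ideal for all prime ideals $\mathfrak{p}$ of $R$. (vi) $\mathrm{Ker}\,\pi_{\mathfrak{p}}$ is a pure ideal for all minimal prime ideals $\mathfrak{p}$ of $R$. (vii) $\mathrm{Ker}\,\pi_{\mathfrak{p}}=\mathrm{Ker}\,\pi_{\mathfrak{q}}$ for all prime ideals $\mathfrak{p}$ and $\mathfrak{q}$ of $R$ with $\mathfrak{p}\subseteq\mathfrak{q}$. (viii) $\mathrm{Ker}\,\pi_{\mathfrak{p}}$ is a primary ideal for all prime ideals $\mathfrak{p}$ of $R$. (ix) $\mathrm{Ker}\,\pi_{\mathfrak{m}}$ is a primary ideal for all maximal ideals $\mathfrak{m}$ of $R$.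
   Context: All rings are commutative with identity. $\mathfrak{N}$ denotes the nil-radical of $R$, and $\mathrm{Ann}(a)=\{r\in R: ra=0\}$. An ideal $I$ of $R$ is called pure if for each $a\in I$ there exists $b\in I$ such that $a(1-b)=0$, and N-pure if for every $a\in I$ there exists $b\in I$ such that $a(1-b)\in\mathfrak{N}$. A ring $R$ is called a mid ring if for every $a\in R$, $\mathrm{Ann}(a)$ is an N-pure ideal. A ring is a primary ring if its zero ideal is a primary ideal. For a prime ideal $\mathfrak{p}$, $\pi_{\mathfrak{p}}:R\to R_{\mathfrak{p}}$ is the canonical localization map, so $\mathrm{Ker}\,\pi_{\mathfrak{p}}=\{a\in R:\exists s\in R\setminus\mathfrak{p},\ sa=0\}$. *)

theory Defs
  imports "HOL-Algebra.QuotRing"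
begin

definition annihilator :: "('a, 'b) ring_scheme \<Rightarrow> 'a \<Rightarrow> 'a set"
  where "annihilator R a = {r \<in> carrier R. r \<otimes>\<^bsub>R\<^esub> a = \<zero>\<^bsub>R\<^esub>}"

definition nilradical :: "('a, 'b) ring_scheme \<Rightarrow> 'a set"
  where "nilradical R = {r \<in> carrier R. \<exists>n::nat. n \<ge> 1 \<and> r [^]\<^bsub>R\<^esub> n = \<zero>\<^bsub>R\<^esub>}"

definition pure_ideal :: "'a set \<Rightarrow> ('a, 'b) ring_scheme \<Rightarrow> bool"
  where "pure_ideal I R \<longleftrightarrow> ideal I R \<and>
    (\<forall>a\<in>I. \<exists>b\<in>I. a \<otimes>\<^bsub>R\<^esub> (\<one>\<^bsub>R\<^esub> \<ominus>\<^bsub>R\<^esub> b) = \<zero>\<^bsub>R\<^esub>)"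

definition N_pure_ideal :: "'a set \<Rightarrow> ('a, 'b) ring_scheme \<Rightarrow> bool"
  where "N_pure_ideal I R \<longleftrightarrow> ideal I R \<and>
    (\<forall>a\<in>I. \<exists>b\<in>I. a \<otimes>\<^bsub>R\<^esub> (\<one>\<^bsub>R\<^esub> \<ominus>\<^bsub>R\<^esub> b) \<in> nilradical R)"

definition mid_ring :: "('a, 'b) ring_scheme \<Rightarrow> bool"
  where "mid_ring R \<longleftrightarrow> cring R \<and> (\<forall>a\<in>carrier R. N_pure_ideal (annihilator R a) R)"

text \<open>As usual, a primary ideal is required to be proper, so the zero ring is not a primary ring.\<close>

definition primary_ideal :: "'a set \<Rightarrow> ('a, 'b) ring_scheme \<Rightarrow> bool"
  where "primary_ideal I R \<longleftrightarrow> ideal I R \<and> I \<noteq> carrier R \<and>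
    (\<forall>a\<in>carrier R. \<forall>b\<in>carrier R. a \<otimes>\<^bsub>R\<^esub> b \<in> I \<longrightarrow>
       a \<in> I \<or> (\<exists>n::nat. n \<ge> 1 \<and> b [^]\<^bsub>R\<^esub> n \<in> I))"

definition primary_ring :: "('a, 'b) ring_scheme \<Rightarrow> bool"
  where "primary_ring R \<longleftrightarrow> cring R \<and> primary_ideal {\<zero>\<^bsub>R\<^esub>} R"

definition minimal_primeideal :: "'a set \<Rightarrow> ('a, 'b) ring_scheme \<Rightarrow> bool"
  where "minimal_primeideal P R \<longleftrightarrow> primeideal P R \<and> (\<forall>Q. primeideal Q R \<and> Q \<subseteq> P \<longrightarrow> Q = P)"


text \<open>
  The ring of fractions of \<open>R\<close> with denominators in a multiplicative set \<open>S\<close>: the fraction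
  \<open>a / s\<close> is the class of \<open>(a, s)\<close>, and the operations are taken over all representatives
  (see \<open>localization_mult\<close> and \<open>localization_add\<close> for well-definedness).
\<close>

definition frac_rel :: "('a, 'b) ring_scheme \<Rightarrow> 'a set \<Rightarrow> (('a \<times> 'a) \<times> ('a \<times> 'a)) set"
  where "frac_rel R S = {((a, s), (b, t)). a \<in> carrier R \<and> s \<in> S \<and> b \<in> carrier R \<and> t \<in> S \<and>
    (\<exists>u\<in>S. u \<otimes>\<^bsub>R\<^esub> (a \<otimes>\<^bsub>R\<^esub> t \<ominus>\<^bsub>R\<^esub> b \<otimes>\<^bsub>R\<^esub> s) = \<zero>\<^bsub>R\<^esub>)}"

definition frac :: "('a, 'b) ring_scheme \<Rightarrow> 'a set \<Rightarrow> 'a \<Rightarrow> 'a \<Rightarrow> ('a \<times> 'a) set"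
  where "frac R S a s = frac_rel R S `` {(a, s)}"

definition localization :: "('a, 'b) ring_scheme \<Rightarrow> 'a set \<Rightarrow> ('a \<times> 'a) set ring"
  where "localization R S =
    \<lparr> carrier = (carrier R \<times> S) // frac_rel R S,
      mult = (\<lambda>A B. \<Union>(a, s)\<in>A. \<Union>(b, t)\<in>B. frac R S (a \<otimes>\<^bsub>R\<^esub> b) (s \<otimes>\<^bsub>R\<^esub> t)),
      one = frac R S \<one>\<^bsub>R\<^esub> \<one>\<^bsub>R\<^esub>,
      zero = frac R S \<zero>\<^bsub>R\<^esub> \<one>\<^bsub>R\<^esub>,
      add = (\<lambda>A B. \<Union>(a, s)\<in>A. \<Union>(b, t)\<in>B.
        frac R S (a \<otimes>\<^bsub>R\<^esub> t \<oplus>\<^bsub>R\<^esub> b \<otimes>\<^bsub>R\<^esub> s) (s \<otimes>\<^bsub>R\<^esub> t)) \<rparr>"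

definition localization_at :: "('a, 'b) ring_scheme \<Rightarrow> 'a set \<Rightarrow> ('a \<times> 'a) set ring"
  where "localization_at R P = localization R (carrier R - P)"

definition loc_map :: "('a, 'b) ring_scheme \<Rightarrow> 'a set \<Rightarrow> 'a \<Rightarrow> ('a \<times> 'a) set"
  where "loc_map R P a = frac R (carrier R - P) a \<one>\<^bsub>R\<^esub>"

definition loc_ker :: "('a, 'b) ring_scheme \<Rightarrow> 'a set \<Rightarrow> 'a set"
  where "loc_ker R P = a_kernel R (localization_at R P) (loc_map R P)"


locale mult_submonoid = cring R + submonoid S R for R (structure) and S
begin

lemma S_carrier: "s \<in> S \<Longrightarrow> s \<in> carrier R"
  using subset by blast

lemma equiv_frac_rel: "equiv (carrier R \<times> S) (frac_rel R S)"
proof (rule equivI)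
  show "frac_rel R S \<subseteq> (carrier R \<times> S) \<times> (carrier R \<times> S)"
    by (auto simp: frac_rel_def)
  have "u \<otimes> (a \<otimes> s \<ominus> a \<otimes> s) = \<zero>"
    if "u \<in> carrier R" "a \<in> carrier R" "s \<in> carrier R" for u a s
    using that by algebra
  then show "refl_on (carrier R \<times> S) (frac_rel R S)"
    by (auto simp: refl_on_def frac_rel_def intro!: bexI[of _ \<one>] S_carrier)
  have "u \<otimes> (b \<otimes> s \<ominus> a \<otimes> t) = \<zero>"
    if "u \<in> carrier R" "a \<in> carrier R" "s \<in> carrier R" "b \<in> carrier R" "t \<in> carrier R"
      "u \<otimes> (a \<otimes> t \<ominus> b \<otimes> s) = \<zero>" for u a s b t
  proof -
    have "u \<otimes> (b \<otimes> s \<ominus> a \<otimes> t) = \<ominus> (u \<otimes> (a \<otimes> t \<ominus> b \<otimes> s))"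
      using that(1-5) by algebra
    with that show ?thesis by simp
  qed
  then show "sym (frac_rel R S)"
    by (auto simp: sym_def frac_rel_def intro: S_carrier) (meson S_carrier)
  show "trans (frac_rel R S)"
  proof (rule transI, clarsimp simp: frac_rel_def)
    fix a s b t c w u v
    assume A: "a \<in> carrier R" "s \<in> S" "b \<in> carrier R" "t \<in> S" "c \<in> carrier R" "w \<in> S"
      "u \<in> S" "v \<in> S"
      and E: "u \<otimes> (a \<otimes> t \<ominus> b \<otimes> s) = \<zero>" "v \<otimes> (b \<otimes> w \<ominus> c \<otimes> t) = \<zero>"
    note C = A(1,3,5) A(2,4,6,7,8)[THEN S_carrier]
    have "(u \<otimes> v \<otimes> t) \<otimes> (a \<otimes> w \<ominus> c \<otimes> s) =
        v \<otimes> w \<otimes> (u \<otimes> (a \<otimes> t \<ominus> b \<otimes> s)) \<oplus> u \<otimes> s \<otimes> (v \<otimes> (b \<otimes> w \<ominus> c \<otimes> t))"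
      using C by algebra
    also have "\<dots> = \<zero>" unfolding E using C by simp
    finally show "\<exists>u\<in>S. u \<otimes> (a \<otimes> w \<ominus> c \<otimes> s) = \<zero>"
      using A by blast
  qed
qed

lemma frac_eq_iff:
  assumes "a \<in> carrier R" "s \<in> S" "b \<in> carrier R" "t \<in> S"
  shows "frac R S a s = frac R S b t \<longleftrightarrow> (\<exists>u\<in>S. u \<otimes> (a \<otimes> t \<ominus> b \<otimes> s) = \<zero>)"
  using equiv_class_eq_iff[OF equiv_frac_rel, of "(a, s)" "(b, t)"] assms
  by (auto simp: frac_def frac_rel_def)

lemma mem_frac_iff:
  assumes "a \<in> carrier R" "s \<in> S"
  shows "(b, t) \<in> frac R S a s \<longleftrightarrow> b \<in> carrier R \<and> t \<in> S \<and> frac R S b t = frac R S a s"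
  using frac_eq_iff[of a s b t] assms by (auto simp: frac_def frac_rel_def)

lemma carrier_localization: "carrier (localization R S) = {frac R S a s |a s. a \<in> carrier R \<and> s \<in> S}"
  by (auto simp: localization_def quotient_def frac_def)

lemma frac_Union:
  assumes "a \<in> carrier R" "s \<in> S" "b \<in> carrier R" "t \<in> S"
    and "\<And>a' s' b' t'. \<lbrakk>a' \<in> carrier R; s' \<in> S; b' \<in> carrier R; t' \<in> S;
           frac R S a' s' = frac R S a s; frac R S b' t' = frac R S b t\<rbrakk>
         \<Longrightarrow> frac R S (f a' s' b' t') (g a' s' b' t') = Z"
  shows "(\<Union>(a, s)\<in>frac R S a s. \<Union>(b, t)\<in>frac R S b t. frac R S (f a s b t) (g a s b t)) = Z"
proof -
  have "(a, s) \<in> frac R S a s" "(b, t) \<in> frac R S b t"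
    using assms by (simp_all add: mem_frac_iff)
  moreover have "frac R S (f a' s' b' t') (g a' s' b' t') = Z"
    if "(a', s') \<in> frac R S a s" "(b', t') \<in> frac R S b t" for a' s' b' t'
    using that assms by (simp add: mem_frac_iff)
  ultimately show ?thesis by fastforce
qed

lemma localization_mult:
  assumes "a \<in> carrier R" "s \<in> S" "b \<in> carrier R" "t \<in> S"
  shows "frac R S a s \<otimes>\<^bsub>localization R S\<^esub> frac R S b t = frac R S (a \<otimes> b) (s \<otimes> t)"
proof -
  have "frac R S (a' \<otimes> b') (s' \<otimes> t') = frac R S (a \<otimes> b) (s \<otimes> t)"
    if A: "a' \<in> carrier R" "s' \<in> S" "b' \<in> carrier R" "t' \<in> S"
      and E: "frac R S a' s' = frac R S a s" "frac R S b' t' = frac R S b t" for a' s' b' t'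
  proof -
    from E obtain u v where uv: "u \<in> S" "v \<in> S"
      and Z: "u \<otimes> (a' \<otimes> s \<ominus> a \<otimes> s') = \<zero>" "v \<otimes> (b' \<otimes> t \<ominus> b \<otimes> t') = \<zero>"
      using A assms by (auto simp: frac_eq_iff)
    note C = A(1,3) assms(1,3) A(2,4)[THEN S_carrier] assms(2,4)[THEN S_carrier] uv[THEN S_carrier]
    have "(u \<otimes> v) \<otimes> ((a' \<otimes> b') \<otimes> (s \<otimes> t) \<ominus> (a \<otimes> b) \<otimes> (s' \<otimes> t')) =
        v \<otimes> b' \<otimes> t \<otimes> (u \<otimes> (a' \<otimes> s \<ominus> a \<otimes> s')) \<oplus> u \<otimes> a \<otimes> s' \<otimes> (v \<otimes> (b' \<otimes> t \<ominus> b \<otimes> t'))"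
      using C by algebra
    also have "\<dots> = \<zero>" unfolding Z using C by simp
    finally show ?thesis using A assms uv by (auto simp: frac_eq_iff)
  qed
  then show ?thesis
    using frac_Union[OF assms, of "\<lambda>a s b t. a \<otimes> b" "\<lambda>a s b t. s \<otimes> t"]
    by (simp add: localization_def)
qed

lemma localization_add:
  assumes "a \<in> carrier R" "s \<in> S" "b \<in> carrier R" "t \<in> S"
  shows "frac R S a s \<oplus>\<^bsub>localization R S\<^esub> frac R S b t = frac R S (a \<otimes> t \<oplus> b \<otimes> s) (s \<otimes> t)"
proof -
  have "frac R S (a' \<otimes> t' \<oplus> b' \<otimes> s') (s' \<otimes> t') = frac R S (a \<otimes> t \<oplus> b \<otimes> s) (s \<otimes> t)"
    if A: "a' \<in> carrier R" "s' \<in> S" "b' \<in> carrier R" "t' \<in> S"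
      and E: "frac R S a' s' = frac R S a s" "frac R S b' t' = frac R S b t" for a' s' b' t'
  proof -
    from E obtain u v where uv: "u \<in> S" "v \<in> S"
      and Z: "u \<otimes> (a' \<otimes> s \<ominus> a \<otimes> s') = \<zero>" "v \<otimes> (b' \<otimes> t \<ominus> b \<otimes> t') = \<zero>"
      using A assms by (auto simp: frac_eq_iff)
    note C = A(1,3) assms(1,3) A(2,4)[THEN S_carrier] assms(2,4)[THEN S_carrier] uv[THEN S_carrier]
    have "(u \<otimes> v) \<otimes> ((a' \<otimes> t' \<oplus> b' \<otimes> s') \<otimes> (s \<otimes> t) \<ominus> (a \<otimes> t \<oplus> b \<otimes> s) \<otimes> (s' \<otimes> t')) =
        v \<otimes> t \<otimes> t' \<otimes> (u \<otimes> (a' \<otimes> s \<ominus> a \<otimes> s')) \<oplus> u \<otimes> s \<otimes> s' \<otimes> (v \<otimes> (b' \<otimes> t \<ominus> b \<otimes> t'))"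
      using C by algebra
    also have "\<dots> = \<zero>" unfolding Z using C by simp
    finally show ?thesis using A assms uv S_carrier by (auto simp: frac_eq_iff)
  qed
  then show ?thesis
    using frac_Union[OF assms, of "\<lambda>a s b t. a \<otimes> t \<oplus> b \<otimes> s" "\<lambda>a s b t. s \<otimes> t"]
    by (simp add: localization_def)
qed

lemma localization_one: "\<one>\<^bsub>localization R S\<^esub> = frac R S \<one> \<one>"
  and localization_zero: "\<zero>\<^bsub>localization R S\<^esub> = frac R S \<zero> \<one>"
  by (simp_all add: localization_def)

lemma frac_eqI:
  assumes "a \<in> carrier R" "s \<in> S" "b \<in> carrier R" "t \<in> S" "a \<otimes> t = b \<otimes> s"
  shows "frac R S a s = frac R S b t"
proof -
  have "b \<otimes> s \<in> carrier R" using assms S_carrier by simp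
  then have "\<one> \<otimes> (a \<otimes> t \<ominus> b \<otimes> s) = \<zero>" using assms(5) by (simp add: a_minus_def r_neg)
  then show ?thesis using assms(1-4) one_closed by (subst frac_eq_iff) auto
qed

lemma frac_carrier: "\<lbrakk>a \<in> carrier R; s \<in> S\<rbrakk> \<Longrightarrow> frac R S a s \<in> carrier (localization R S)"
  by (auto simp: carrier_localization)

theorem cring_localization: "cring (localization R S)"
proof -
  let ?L = "localization R S"
  note simps = carrier_localization localization_mult localization_add localization_one
    localization_zero S_carrier
  show ?thesis
  proof (intro cringI abelian_groupI Group.comm_monoidI)
    fix x y z assume "x \<in> carrier ?L" "y \<in> carrier ?L" "z \<in> carrier ?L"
    then obtain a s b t c w where
      eq: "x = frac R S a s" "y = frac R S b t" "z = frac R S c w" and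
      A: "a \<in> carrier R" "s \<in> S" "b \<in> carrier R" "t \<in> S" "c \<in> carrier R" "w \<in> S"
      by (auto simp: carrier_localization)
    note C = A(1,3,5) A(2,4,6)[THEN S_carrier]
    show "x \<oplus>\<^bsub>?L\<^esub> y \<oplus>\<^bsub>?L\<^esub> z = x \<oplus>\<^bsub>?L\<^esub> (y \<oplus>\<^bsub>?L\<^esub> z)"
      using A unfolding eq by (simp add: simps) (rule frac_eqI; (simp add: S_carrier)?; use C in algebra)
    show "x \<otimes>\<^bsub>?L\<^esub> y \<otimes>\<^bsub>?L\<^esub> z = x \<otimes>\<^bsub>?L\<^esub> (y \<otimes>\<^bsub>?L\<^esub> z)"
      using A unfolding eq by (simp add: simps m_assoc)
    show "(x \<oplus>\<^bsub>?L\<^esub> y) \<otimes>\<^bsub>?L\<^esub> z = x \<otimes>\<^bsub>?L\<^esub> z \<oplus>\<^bsub>?L\<^esub> y \<otimes>\<^bsub>?L\<^esub> z"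
      using A unfolding eq by (simp add: simps) (rule frac_eqI; (simp add: S_carrier)?; use C in algebra)
  next
    fix x y assume "x \<in> carrier ?L" "y \<in> carrier ?L"
    then obtain a s b t where
      eq: "x = frac R S a s" "y = frac R S b t" and
      A: "a \<in> carrier R" "s \<in> S" "b \<in> carrier R" "t \<in> S"
      by (auto simp: carrier_localization)
    show "x \<oplus>\<^bsub>?L\<^esub> y \<in> carrier ?L" "x \<otimes>\<^bsub>?L\<^esub> y \<in> carrier ?L"
      using A unfolding eq by (simp_all add: localization_mult localization_add frac_carrier S_carrier)
    show "x \<oplus>\<^bsub>?L\<^esub> y = y \<oplus>\<^bsub>?L\<^esub> x" "x \<otimes>\<^bsub>?L\<^esub> y = y \<otimes>\<^bsub>?L\<^esub> x"
      using A unfolding eq by (simp_all add: localization_mult localization_add S_carrier m_comm a_comm)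
  next
    fix x assume "x \<in> carrier ?L"
    then obtain a s where eq: "x = frac R S a s" and A: "a \<in> carrier R" "s \<in> S"
      by (auto simp: carrier_localization)
    show "\<zero>\<^bsub>?L\<^esub> \<oplus>\<^bsub>?L\<^esub> x = x" "\<one>\<^bsub>?L\<^esub> \<otimes>\<^bsub>?L\<^esub> x = x"
      using A unfolding eq by (simp_all add: simps)
    have "frac R S (\<ominus> a) s \<oplus>\<^bsub>?L\<^esub> x = \<zero>\<^bsub>?L\<^esub>"
      using A unfolding eq
      by (simp add: simps) (rule frac_eqI; (simp add: S_carrier)?; use A S_carrier[OF A(2)] in algebra)
    then show "\<exists>y\<in>carrier ?L. y \<oplus>\<^bsub>?L\<^esub> x = \<zero>\<^bsub>?L\<^esub>"
      using A by (meson a_inv_closed frac_carrier)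
  qed (auto simp: localization_one localization_zero intro: frac_carrier)
qed

end

lemma (in primeideal) mult_submonoid_compl: "mult_submonoid R (carrier R - I)"
  using I_notcarr I_prime one_imp_carrier
  by unfold_locales auto

lemma (in primeideal) cring_localization_at: "cring (localization_at R I)"
  using mult_submonoid.cring_localization[OF mult_submonoid_compl] by (simp add: localization_at_def)

lemma (in primeideal) loc_map_hom: "loc_map R I \<in> ring_hom R (localization_at R I)"
proof -
  interpret M: mult_submonoid R "carrier R - I" by (rule mult_submonoid_compl)
  show ?thesis
    by (rule ring_hom_memI)
      (simp_all add: loc_map_def localization_at_def M.frac_carrier M.localization_mult
        M.localization_add M.localization_one del: Diff_iff)
qed

lemma (in primeideal) loc_ker_eq:
  "loc_ker R I = {a \<in> carrier R. \<exists>s\<in>carrier R - I. s \<otimes> a = \<zero>}"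
proof -
  interpret M: mult_submonoid R "carrier R - I" by (rule mult_submonoid_compl)
  have "loc_map R I a = \<zero>\<^bsub>localization_at R I\<^esub> \<longleftrightarrow> (\<exists>s\<in>carrier R - I. s \<otimes> a = \<zero>)"
    if "a \<in> carrier R" for a
    using that
    by (simp add: loc_map_def localization_at_def M.localization_zero M.frac_eq_iff a_minus_def
        del: Diff_iff)
  then show ?thesis
    by (auto simp: loc_ker_def a_kernel_def kernel_def)
qed

end

theory Submission
  imports "HOL-Algebra.Ring_Divisibility" Defs
begin

text \<open>
  Everything is compared with the comaximality condition (ii). It yields the other conditions by
  writing \<open>\<one> = c \<oplus> d\<close> with \<open>c\<close> and \<open>d\<close> in the two annihilators: a prime ideal misses \<open>c\<close> or \<open>d\<close>.
  Conversely, if (ii) fails for \<open>a\<close> and \<open>b\<close> with \<open>a \<otimes> b = \<zero>\<close>, then some maximal ideal \<open>M\<close> contains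
  \<open>Ann(a)\<close> and every \<open>Ann(b\<^sup>n)\<close>. Hence \<open>a\<close> and all powers of \<open>b\<close> lie outside the kernel at \<open>M\<close>,
  which contradicts (ix). Moreover the multiplicative set of all \<open>s \<otimes> b\<^sup>n\<close> with \<open>s \<notin> M\<close> does not
  contain \<open>\<zero>\<close>. A minimal prime ideal \<open>P\<close> disjoint from this set satisfies \<open>P \<subseteq> M\<close> and \<open>b \<notin> P\<close>, so
  \<open>a\<close> does lie in the kernel at \<open>P\<close>; this contradicts both (vi) and (vii). Finally, (iii) and (iv)
  restate (viii) and (ix), because \<open>a / s\<close> vanishes exactly when \<open>a\<close> lies in the kernel.
\<close>

section \<open>Existence of maximal and minimal prime ideals\<close>

context cring
begin

text \<open>Zorn's lemma for an arbitrary set \<open>S\<close>, so that two cases are served at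
  once: \<open>S = {\<one>}\<close> yields maximal ideals, and a multiplicative set \<open>S\<close>
  yields prime ideals.\<close>

lemma ex_maximal_ideal_disjoint:
  assumes "ideal I R" "I \<inter> S = {}"
  shows "\<exists>M. ideal M R \<and> I \<subseteq> M \<and> M \<inter> S = {} \<and>
    (\<forall>J. ideal J R \<longrightarrow> M \<subseteq> J \<longrightarrow> J \<inter> S = {} \<longrightarrow> J = M)"
proof -
  let ?A = "{J. ideal J R \<and> I \<subseteq> J \<and> J \<inter> S = {}}"
  have "\<Union>C \<in> ?A" if C: "C \<noteq> {}" "subset.chain ?A C" for C
  proof -
    have "subset.chain {J. ideal J R} C"
      using C(2) by (auto simp: pred_on.chain_def)
    then have "ideal (\<Union>C) R"
      using chain_Union_is_ideal[of C] C(1) by simp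
    then show ?thesis
      using C by (auto simp: pred_on.chain_def)
  qed
  moreover have "?A \<noteq> {}"
    using assms by blast
  ultimately obtain M where "M \<in> ?A" "\<forall>J\<in>?A. M \<subseteq> J \<longrightarrow> J = M"
    using subset_Zorn_nonempty[of ?A] by meson
  then show ?thesis
    by (intro exI[of _ M]) auto
qed

lemma ex_maximalideal:
  assumes "ideal I R" "I \<noteq> carrier R"
  obtains M where "maximalideal M R" "I \<subseteq> M"
proof -
  \<comment> \<open>Properness is disjointness from \<open>{\<one>}\<close>, so maximality among
    disjoint ideals is maximality among proper ones.\<close>
  have proper: "J \<inter> {\<one>} = {} \<longleftrightarrow> J \<noteq> carrier R" if "ideal J R" for J
    using ideal.one_imp_carrier[OF that] by auto
  have "I \<inter> {\<one>} = {}"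
    using assms proper by simp
  from ex_maximal_ideal_disjoint[OF assms(1) this]
  obtain M where M: "ideal M R" "I \<subseteq> M" "M \<inter> {\<one>} = {}"
    and max: "\<forall>J. ideal J R \<longrightarrow> M \<subseteq> J \<longrightarrow> J \<inter> {\<one>} = {} \<longrightarrow> J = M"
    by auto
  have "maximalideal M R"
    by (rule maximalidealI) (use M max proper in auto)
  with M(2) show ?thesis using that by blast
qed

text \<open>An ideal maximal among those avoiding a multiplicative set is prime: if \<open>a\<close>
  and \<open>b\<close> lie outside it, both enlarged ideals meet \<open>S\<close>, and the product
  of the two meeting points would lie in \<open>S\<close> and, if
  \<open>a \<otimes> b \<in> P\<close>, in \<open>P\<close>.\<close>

lemma ex_primeideal_disjoint:
  assumes "submonoid S R" "\<zero> \<notin> S"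
  obtains P where "primeideal P R" "P \<inter> S = {}"
proof -
  interpret S: submonoid S R by fact
  have "{\<zero>} \<inter> S = {}"
    using assms(2) by simp
  from ex_maximal_ideal_disjoint[OF zeroideal this]
  obtain P where P: "ideal P R" "P \<inter> S = {}"
    and max: "\<forall>J. ideal J R \<longrightarrow> P \<subseteq> J \<longrightarrow> J \<inter> S = {} \<longrightarrow> J = P"
    by auto
  interpret P: ideal P R by fact
  \<comment> \<open>The ideal generated by \<open>P\<close> and \<open>x\<close> is strictly larger
    than \<open>P\<close>, so by maximality it cannot avoid \<open>S\<close>.\<close>
  have meets: "\<exists>m\<in>P. \<exists>r\<in>carrier R. m \<oplus> r \<otimes> x \<in> S" if x: "x \<in> carrier R" "x \<notin> P" for x
  proof -
    have J: "ideal (P <+> PIdl x) R"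
      by (rule add_ideals[OF P(1) cgenideal_ideal[OF x(1)]])
    have sub: "P \<subseteq> P <+> PIdl x"
    proof
      fix m assume "m \<in> P"
      moreover have "\<zero> \<in> PIdl x"
        by (rule additive_subgroup.zero_closed[OF ideal.axioms(1)[OF cgenideal_ideal[OF x(1)]]])
      moreover have "m = m \<oplus> \<zero>"
        using P.Icarr[OF \<open>m \<in> P\<close>] by simp
      ultimately show "m \<in> P <+> PIdl x"
        unfolding set_add_def' by blast
    qed
    have "x = \<zero> \<oplus> x"
      using x(1) by simp
    then have "x \<in> P <+> PIdl x"
      unfolding set_add_def' using cgenideal_self[OF x(1)] P.zero_closed by blast
    then have "(P <+> PIdl x) \<inter> S \<noteq> {}"
      using max J sub x(2) by blast
    then show ?thesis
      by (auto simp: set_add_def' cgenideal_def)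
  qed
  have "primeideal P R"
  proof (rule primeidealI[OF P(1) is_cring])
    show "carrier R \<noteq> P"
      using P(2) S.one_closed by auto
    fix a b assume ab: "a \<in> carrier R" "b \<in> carrier R" "a \<otimes> b \<in> P"
    show "a \<in> P \<or> b \<in> P"
    proof (rule ccontr)
      assume "\<not> (a \<in> P \<or> b \<in> P)"
      then have "a \<notin> P" "b \<notin> P" by simp_all
      obtain m r where mr: "m \<in> P" "r \<in> carrier R" "m \<oplus> r \<otimes> a \<in> S"
        using meets[OF ab(1) \<open>a \<notin> P\<close>] by blast
      obtain n t where nt: "n \<in> P" "t \<in> carrier R" "n \<oplus> t \<otimes> b \<in> S"
        using meets[OF ab(2) \<open>b \<notin> P\<close>] by blast
      note carr = P.Icarr[OF mr(1)] mr(2) P.Icarr[OF nt(1)] nt(2) ab(1,2)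
      \<comment> \<open>Expanded so that each summand visibly has a factor in \<open>P\<close>:
        \<open>m\<close>, \<open>n\<close> or \<open>a \<otimes> b\<close>.\<close>
      have "(m \<oplus> r \<otimes> a) \<otimes> (n \<oplus> t \<otimes> b)
          = m \<otimes> (n \<oplus> t \<otimes> b) \<oplus> ((r \<otimes> a) \<otimes> n \<oplus> (r \<otimes> t) \<otimes> (a \<otimes> b))"
        using carr by algebra
      moreover have "m \<otimes> (n \<oplus> t \<otimes> b) \<in> P"
        using mr(1) carr by (simp add: P.I_r_closed)
      moreover have "(r \<otimes> a) \<otimes> n \<in> P" "(r \<otimes> t) \<otimes> (a \<otimes> b) \<in> P"
        using nt(1) ab(3) carr by (simp_all add: P.I_l_closed)
      ultimately have "(m \<oplus> r \<otimes> a) \<otimes> (n \<oplus> t \<otimes> b) \<in> P"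
        by simp
      then show False
        using S.m_closed[OF mr(3) nt(3)] P(2) by blast
    qed
  qed
  with P(2) show ?thesis using that by blast
qed

text \<open>A maximal multiplicative set without \<open>\<zero>\<close> is the complement of a minimal prime ideal.\<close>

lemma ex_minimal_primeideal_disjoint:
  assumes "submonoid T R" "\<zero> \<notin> T"
  obtains P where "minimal_primeideal P R" "P \<inter> T = {}"
proof -
  let ?A = "{S. submonoid S R \<and> T \<subseteq> S \<and> \<zero> \<notin> S}"
  have "\<Union>C \<in> ?A" if C: "C \<noteq> {}" "subset.chain ?A C" for C
  proof -
    have sub: "submonoid S R" if "S \<in> C" for S
      using C(2) that by (auto simp: pred_on.chain_def)
    have "submonoid (\<Union>C) R"
    proof
      show "\<Union>C \<subseteq> carrier R"
        by (rule Union_least) (rule submonoid.subset[OF sub])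
      obtain U where "U \<in> C" using C(1) by blast
      then show "\<one> \<in> \<Union>C"
        using submonoid.one_closed[OF sub] by blast
      fix x y assume "x \<in> \<Union>C" "y \<in> \<Union>C"
      then obtain U V where UV: "U \<in> C" "V \<in> C" "x \<in> U" "y \<in> V" by blast
      have "U \<subseteq> V \<or> V \<subseteq> U"
        using subset.chain_total[OF C(2) UV(1,2)] by blast
      then obtain W where "W \<in> C" "x \<in> W" "y \<in> W"
        using UV by blast
      then show "x \<otimes> y \<in> \<Union>C"
        using submonoid.m_closed[OF sub] by blast
    qed
    then show ?thesis
      using C by (auto simp: pred_on.chain_def)
  qed
  then obtain S where S: "S \<in> ?A" and max: "\<forall>U\<in>?A. S \<subseteq> U \<longrightarrow> U = S"
    using subset_Zorn_nonempty[of ?A] assms by blast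
  then obtain P where P: "primeideal P R" "P \<inter> S = {}"
    using ex_primeideal_disjoint[of S] by blast
  \<comment> \<open>The complement of such a prime is again a member of \<open>?A\<close> containing
    \<open>S\<close>, so maximality forces equality. A prime inside \<open>P\<close> also avoids
    \<open>S\<close>, hence has the same complement as \<open>P\<close>.\<close>
  have compl: "carrier R - Q = S" if Q: "primeideal Q R" "Q \<inter> S = {}" for Q
  proof -
    have "submonoid (carrier R - Q) R"
      using primeideal.mult_submonoid_compl[OF Q(1)] by (simp add: mult_submonoid_def)
    moreover have "\<zero> \<in> Q"
      using additive_subgroup.zero_closed[OF ideal.axioms(1)[OF primeideal.axioms(1)[OF Q(1)]]] .
    moreover have "S \<subseteq> carrier R - Q"
      using S Q(2) submonoid.subset[of S R] by blast
    ultimately show ?thesis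
      using S max by blast
  qed
  have "Q = P" if Q: "primeideal Q R" "Q \<subseteq> P" for Q
  proof -
    have "Q \<subseteq> carrier R" "P \<subseteq> carrier R"
      using ideal.Icarr[OF primeideal.axioms(1)] P(1) Q(1) by (auto intro: subsetI)
    moreover have "carrier R - Q = carrier R - P"
      using compl P Q by blast
    ultimately show ?thesis by blast
  qed
  then have "minimal_primeideal P R"
    using P(1) by (auto simp: minimal_primeideal_def)
  moreover have "P \<inter> T = {}"
    using P(2) S by blast
  ultimately show ?thesis using that by blast
qed


section \<open>Annihilators\<close>

lemma annihilator_subset: "annihilator R a \<subseteq> carrier R"
  by (auto simp: annihilator_def)

lemma ideal_annihilator:
  assumes "a \<in> carrier R"
  shows "ideal (annihilator R a) R"
proof (rule idealI[OF ring_axioms])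
  show "subgroup (annihilator R a) (add_monoid R)"
    by (rule add.subgroupI) (use assms in \<open>auto simp: annihilator_def l_distr l_minus\<close>)
next
  fix r x assume "r \<in> annihilator R a" and x: "x \<in> carrier R"
  then have r: "r \<in> carrier R" "r \<otimes> a = \<zero>"
    by (auto simp: annihilator_def)
  with x show "x \<otimes> r \<in> annihilator R a"
    using assms by (simp add: annihilator_def m_assoc)
  with r(1) x show "r \<otimes> x \<in> annihilator R a"
    by (simp add: m_comm)
qed

lemma annihilator_mono_mult:
  assumes "a \<in> carrier R" "b \<in> carrier R"
  shows "annihilator R a \<subseteq> annihilator R (a \<otimes> b)"
proof
  fix r assume "r \<in> annihilator R a"
  then have "r \<in> carrier R" "r \<otimes> a = \<zero>"
    by (auto simp: annihilator_def)
  then show "r \<in> annihilator R (a \<otimes> b)"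
    using assms m_assoc[of r a b, symmetric] by (simp add: annihilator_def)
qed

text \<open>Follows from factoring the larger power as
  \<open>b [^] m \<otimes> b [^] (n - m)\<close>. It makes the ideals attached to successive powers
  of \<open>b\<close> an ascending chain.\<close>

lemma annihilator_pow_mono:
  assumes "b \<in> carrier R" "m \<le> n"
  shows "annihilator R (b [^] (m::nat)) \<subseteq> annihilator R (b [^] n)"
  using annihilator_mono_mult[of "b [^] m" "b [^] (n - m)"] assms by (simp add: nat_pow_mult)

section \<open>Comaximality of annihilators and obstructions to it\<close>

lemma comaximal_annihilators_iff:
  assumes "a \<in> carrier R" "b \<in> carrier R"
  shows "annihilator R a <+> annihilator R b = carrier R \<longleftrightarrow>
    (\<exists>c\<in>carrier R. \<exists>d\<in>carrier R. c \<oplus> d = \<one> \<and> c \<otimes> a = \<zero> \<and> d \<otimes> b = \<zero>)"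
    (is "?I = carrier R \<longleftrightarrow> ?R")
proof -
  have "ideal ?I R"
    using assms by (intro add_ideals ideal_annihilator)
  then have "?I = carrier R \<longleftrightarrow> \<one> \<in> ?I"
    using ideal.one_imp_carrier by blast
  also have "\<dots> \<longleftrightarrow> ?R"
    by (auto simp: set_add_def' annihilator_def) metis+
  finally show ?thesis .
qed

text \<open>If comaximality fails for every exponent, the sums of annihilators form an ascending
  chain of proper ideals. Their union omits \<one>, so some maximal ideal contains all of
  them.\<close>

lemma comaximal_if_no_maximalideal:
  assumes ab: "a \<in> carrier R" "b \<in> carrier R"
    and M: "\<And>M. \<lbrakk>maximalideal M R; annihilator R a \<subseteq> M;
      \<And>n::nat. annihilator R (b [^] n) \<subseteq> M\<rbrakk> \<Longrightarrow> False"
  shows "\<exists>n::nat. n \<ge> 1 \<and> annihilator R a <+> annihilator R (b [^] n) = carrier R"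
proof (rule ccontr)
  assume neg: "\<not> ?thesis"
  \<comment> \<open>The exponent is shifted to \<open>Suc n\<close> because the negated claim only
    speaks of exponents at least 1; exponent 0 is recovered at the end by monotonicity.\<close>
  define J :: "nat \<Rightarrow> 'a set" where "J n = annihilator R a <+> annihilator R (b [^] Suc n)" for n
  have J: "ideal (J n) R" for n
    unfolding J_def using ab by (intro add_ideals ideal_annihilator) auto
  have mono: "J m \<subseteq> J n" if "m \<le> n" for m n
    unfolding J_def using annihilator_pow_mono[of b "Suc m" "Suc n"] ab that
    by (auto simp: set_add_def' simp del: nat_pow_Suc)
  have "J m \<subseteq> J n \<or> J n \<subseteq> J m" for m n
    using mono[of m n] mono[of n m] nat_le_linear[of m n] by blast
  then have "subset.chain {I. ideal I R} (range J)"
    using J by (auto simp only: subset_chain_def)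
  then have U: "ideal (\<Union>(range J)) R"
    using chain_Union_is_ideal[of "range J"] by simp
  have "\<one> \<notin> J n" for n
  proof -
    have "Suc n \<ge> 1" by simp
    then have "J n \<noteq> carrier R"
      using neg unfolding J_def by blast
    then show ?thesis
      using ideal.one_imp_carrier[OF J[of n]] by blast
  qed
  then have "\<Union>(range J) \<noteq> carrier R"
    by blast
  then obtain M where M': "maximalideal M R" "\<Union>(range J) \<subseteq> M"
    using ex_maximalideal[OF U] by blast
  have sub: "annihilator R a \<subseteq> J n" "annihilator R (b [^] Suc n) \<subseteq> J n" for n
  proof -
    have "\<zero> \<in> annihilator R a" "\<zero> \<in> annihilator R (b [^] Suc n)"
      using ab by (auto simp: annihilator_def)
    then show "annihilator R a \<subseteq> J n" "annihilator R (b [^] Suc n) \<subseteq> J n"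
      using annihilator_subset unfolding J_def set_add_def' by force+
  qed
  show False
  proof (rule M[OF M'(1)])
    show "annihilator R a \<subseteq> M" using sub(1)[of 0] M'(2) by blast
    show "annihilator R (b [^] n) \<subseteq> M" for n :: nat
      using sub(2)[of n] annihilator_pow_mono[of b n "Suc n"] ab M'(2) by (blast intro: le_SucI)
  qed
qed

text \<open>Adds to the maximal ideal \<open>M\<close> of the previous obstruction a minimal prime
  inside it that omits \<open>b\<close>. Conditions (vi) and (vii) can only be exploited through
  such a pair.\<close>

lemma comaximal_if_no_minimal_primeideal:
  assumes ab: "a \<in> carrier R" "b \<in> carrier R"
    and PM: "\<And>P M. \<lbrakk>minimal_primeideal P R; maximalideal M R; P \<subseteq> M; b \<notin> P;
      annihilator R a \<subseteq> M\<rbrakk> \<Longrightarrow> False"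
  shows "\<exists>n::nat. n \<ge> 1 \<and> annihilator R a <+> annihilator R (b [^] n) = carrier R"
proof (rule comaximal_if_no_maximalideal[OF ab])
  fix M assume M: "maximalideal M R" "annihilator R a \<subseteq> M"
    and bM: "\<And>n::nat. annihilator R (b [^] n) \<subseteq> M"
  interpret M: primeideal M R by (rule maximalideal_prime[OF M(1)])
  interpret C: mult_submonoid R "carrier R - M" by (rule M.mult_submonoid_compl)
  \<comment> \<open>The multiplicative set generated by the complement of \<open>M\<close> and
    \<open>b\<close>. Taking \<open>n = 0\<close> shows that a prime avoiding it lies in
    \<open>M\<close>; taking \<open>s = \<one>\<close> and \<open>n = 1\<close> shows that it omits
    \<open>b\<close>.\<close>
  let ?T = "{s \<otimes> b [^] n |s (n::nat). s \<in> carrier R - M}"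
  have T: "submonoid ?T R"
  proof
    show "?T \<subseteq> carrier R" using ab by auto
    have "\<one> = \<one> \<otimes> b [^] (0::nat)" by simp
    then show "\<one> \<in> ?T" using C.submonoid_axioms submonoid.one_closed by blast
    fix x y assume "x \<in> ?T" "y \<in> ?T"
    then obtain s t and m n :: nat where st: "x = s \<otimes> b [^] m" "y = t \<otimes> b [^] n"
      "s \<in> carrier R - M" "t \<in> carrier R - M" by blast
    have "x \<otimes> y = (s \<otimes> t) \<otimes> (b [^] m \<otimes> b [^] n)"
      unfolding st(1,2) using st(3,4) ab by (simp add: m_ac)
    also have "\<dots> = (s \<otimes> t) \<otimes> b [^] (m + n)"
      using ab by (simp add: nat_pow_mult)
    finally have "x \<otimes> y = (s \<otimes> t) \<otimes> b [^] (m + n)" .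
    moreover have "s \<otimes> t \<in> carrier R - M"
      using st(3,4) M.I_prime by blast
    ultimately show "x \<otimes> y \<in> ?T" by blast
  qed
  have "\<zero> \<notin> ?T"
  proof
    assume "\<zero> \<in> ?T"
    \<comment> \<open>Here \<open>s\<close> annihilates \<open>b [^] n\<close>, so it would lie in
      \<open>M\<close>.\<close>
    then obtain s and n :: nat where "s \<in> carrier R - M" "s \<otimes> b [^] n = \<zero>" by auto
    then show False using bM[of n] by (auto simp: annihilator_def)
  qed
  then obtain P where P: "minimal_primeideal P R" "P \<inter> ?T = {}"
    using ex_minimal_primeideal_disjoint[OF T] by blast
  interpret P: primeideal P R using P(1) by (simp add: minimal_primeideal_def)
  have "P \<subseteq> M"
  proof
    fix x assume x: "x \<in> P"
    have "x = x \<otimes> b [^] (0::nat)" using P.Icarr[OF x] by simp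
    then show "x \<in> M" using x P.Icarr[OF x] P(2) by blast
  qed
  moreover have "b = \<one> \<otimes> b [^] (1::nat)" using ab by simp
  then have "b \<in> ?T" using C.submonoid_axioms submonoid.one_closed by blast
  then have "b \<notin> P" using P(2) by blast
  ultimately show False using PM P(1) M by blast
qed


section \<open>Mid rings and comaximal annihilators\<close>

text \<open>Condition (ii) under a name, since every other condition is compared with it.\<close>

definition comaximal_annihilators :: bool
  where "comaximal_annihilators \<longleftrightarrow> (\<forall>a\<in>carrier R. \<forall>b\<in>carrier R. a \<otimes> b = \<zero> \<longrightarrow>
    (\<exists>n::nat. n \<ge> 1 \<and> annihilator R a <+> annihilator R (b [^] n) = carrier R))"

lemma comaximal_annihilatorsE:
  assumes "comaximal_annihilators" "a \<in> carrier R" "b \<in> carrier R" "a \<otimes> b = \<zero>"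
  obtains n c d where "n \<ge> 1" "c \<in> carrier R" "d \<in> carrier R" "c \<oplus> d = \<one>"
    "c \<otimes> a = \<zero>" "d \<otimes> b [^] (n::nat) = \<zero>"
proof -
  obtain n :: nat where "n \<ge> 1" "annihilator R a <+> annihilator R (b [^] n) = carrier R"
    using assms unfolding comaximal_annihilators_def by blast
  then show ?thesis
    using that assms comaximal_annihilators_iff[of a "b [^] n"] by auto
qed

text \<open>Multiplication by \<open>\<one> \<ominus> c\<close> fixes \<open>a\<close>, hence so
  does multiplication by each of its powers.\<close>

lemma one_minus_pow_annihilates:
  assumes "c \<in> carrier R" "a \<in> carrier R" "c \<otimes> a = \<zero>"
  shows "(\<one> \<ominus> (\<one> \<ominus> c) [^] (n::nat)) \<otimes> a = \<zero>"
proof -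
  have "(\<one> \<ominus> c) [^] n \<otimes> a = a"
  proof (induction n)
    case (Suc n)
    have "(\<one> \<ominus> c) \<otimes> a = a \<ominus> c \<otimes> a"
      using assms(1,2) by algebra
    then have "(\<one> \<ominus> c) \<otimes> a = a"
      using assms by (simp add: a_minus_def)
    then show ?case using Suc assms by (simp add: m_assoc)
  qed (use assms in simp)
  moreover have "(\<one> \<ominus> x) \<otimes> a = a \<ominus> x \<otimes> a" if "x \<in> carrier R" for x
    using that assms by algebra
  ultimately show ?thesis using assms by (simp add: a_minus_def r_neg)
qed

text \<open>Both directions rest on splitting \<one>. N-purity gives \<open>c\<close> in the
  annihilator of \<open>a\<close> with \<open>b \<otimes> (\<one> \<ominus> c)\<close> nilpotent,
  and the splitting uses \<open>?d = (\<one> \<ominus> c) [^] n\<close> and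
  \<open>\<one> \<ominus> ?d\<close>. Conversely, a splitting \<open>c \<oplus> d = \<one>\<close>
  has \<open>d = \<one> \<ominus> c\<close>, and \<open>b \<otimes> d\<close> is nilpotent.\<close>

lemma mid_ring_iff_comaximal_annihilators: "mid_ring R \<longleftrightarrow> comaximal_annihilators"
proof
  assume mid: "mid_ring R"
  show "comaximal_annihilators"
    unfolding comaximal_annihilators_def
  proof (intro ballI impI)
    fix a b assume ab: "a \<in> carrier R" "b \<in> carrier R" "a \<otimes> b = \<zero>"
    then have "b \<in> annihilator R a"
      by (simp add: annihilator_def m_comm)
    then obtain c where c: "c \<in> annihilator R a" "b \<otimes> (\<one> \<ominus> c) \<in> nilradical R"
      using mid ab unfolding mid_ring_def N_pure_ideal_def by blast
    then obtain n :: nat where n: "n \<ge> 1" "(b \<otimes> (\<one> \<ominus> c)) [^] n = \<zero>"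
      by (auto simp: nilradical_def)
    have cc: "c \<in> carrier R" "c \<otimes> a = \<zero>"
      using c(1) by (auto simp: annihilator_def)
    let ?d = "(\<one> \<ominus> c) [^] n"
    have d: "?d \<in> carrier R" using cc by simp
    have "?d \<otimes> b [^] n = \<zero>"
      using n(2) ab cc by (simp add: nat_pow_distrib m_comm)
    moreover have "(\<one> \<ominus> ?d) \<oplus> ?d = \<one>"
      using d by algebra
    moreover have "(\<one> \<ominus> ?d) \<otimes> a = \<zero>"
      by (rule one_minus_pow_annihilates[OF cc(1) ab(1) cc(2)])
    moreover have "\<one> \<ominus> ?d \<in> carrier R"
      using d by simp
    ultimately have "annihilator R a <+> annihilator R (b [^] n) = carrier R"
      using comaximal_annihilators_iff[OF ab(1), of "b [^] n"] ab(2) d by blast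
    then show "\<exists>n::nat. n \<ge> 1 \<and> annihilator R a <+> annihilator R (b [^] n) = carrier R"
      using n(1) by blast
  qed
next
  assume comax: "comaximal_annihilators"
  have "\<exists>c\<in>annihilator R a. b \<otimes> (\<one> \<ominus> c) \<in> nilradical R"
    if a: "a \<in> carrier R" and b: "b \<in> annihilator R a" for a b
  proof -
    have b': "b \<in> carrier R" "a \<otimes> b = \<zero>"
      using a b by (auto simp: annihilator_def m_comm)
    obtain n c d where n: "n \<ge> 1" and cd: "c \<in> carrier R" "d \<in> carrier R" "c \<oplus> d = \<one>"
      "c \<otimes> a = \<zero>" "d \<otimes> b [^] (n::nat) = \<zero>"
      using comaximal_annihilatorsE[OF comax a b'] .
    have "d = (c \<oplus> d) \<ominus> c" using cd(1,2) by algebra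
    then have d: "\<one> \<ominus> c = d" using cd(3) by simp
    \<comment> \<open>As \<open>n\<close> is positive, one factor \<open>d\<close> can be split off
      \<open>d [^] n\<close> to annihilate \<open>b [^] n\<close>.\<close>
    obtain m where m: "n = Suc m" using n by (cases n) auto
    have "(b \<otimes> d) [^] n = b [^] n \<otimes> d [^] n"
      using b'(1) cd(2) by (rule nat_pow_distrib)
    also have "\<dots> = b [^] n \<otimes> (d [^] m \<otimes> d)"
      by (simp add: m)
    also have "\<dots> = d [^] m \<otimes> (d \<otimes> b [^] n)"
      using b'(1) cd(2) by (simp add: m_ac)
    also have "\<dots> = \<zero>"
      unfolding cd(5) using cd by simp
    finally show ?thesis
      using cd b' n d unfolding nilradical_def annihilator_def by (intro bexI[of _ c]) auto
  qed
  then show "mid_ring R"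
    using is_cring ideal_annihilator by (simp add: mid_ring_def N_pure_ideal_def)
qed

end


section \<open>Kernels of localization maps\<close>

context primeideal
begin

section \<open>Elementary properties of the kernel and of the prime ideal\<close>

lemma mem_loc_ker_iff:
  "a \<in> loc_ker R I \<longleftrightarrow> a \<in> carrier R \<and> (\<exists>s\<in>carrier R. s \<notin> I \<and> s \<otimes> a = \<zero>)"
  by (auto simp: loc_ker_eq)

text \<open>The form in which inclusions of annihilators in a maximal ideal contradict membership in
  the kernel.\<close>

lemma loc_ker_iff_annihilator:
  "a \<in> carrier R \<Longrightarrow> a \<in> loc_ker R I \<longleftrightarrow> \<not> annihilator R a \<subseteq> I"
  by (auto simp: mem_loc_ker_iff annihilator_def)

lemma ideal_loc_ker: "ideal (loc_ker R I) R"
proof -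
  interpret h: ring_hom_ring R "localization_at R I" "loc_map R I"
    using loc_map_hom cring_localization_at ring_axioms
    by (intro ring_hom_ringI2) (auto dest: cring.axioms(1))
  show ?thesis
    unfolding loc_ker_def by (rule h.kernel_is_ideal)
qed

lemma loc_ker_subset: "loc_ker R I \<subseteq> I"
proof
  fix a assume "a \<in> loc_ker R I"
  then obtain s where "a \<in> carrier R" "s \<in> carrier R" "s \<notin> I" "s \<otimes> a = \<zero>"
    by (auto simp: mem_loc_ker_iff)
  then show "a \<in> I" using I_prime[of s a] zero_closed by simp
qed

lemma one_notin: "\<one> \<notin> I"
  using I_notcarr one_imp_carrier by blast

lemma pow_notin: "\<lbrakk>s \<in> carrier R; s \<notin> I\<rbrakk> \<Longrightarrow> s [^] (n::nat) \<notin> I"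
proof (induction n)
  case 0
  then show ?case using one_notin by simp
next
  case (Suc n)
  then show ?case using I_prime[of "s [^] n" s] by auto
qed

lemma add_eq_one_notin: "\<lbrakk>c \<oplus> d = \<one>; c \<in> I\<rbrakk> \<Longrightarrow> d \<notin> I"
  using one_notin additive_subgroup.a_closed[OF is_additive_subgroup, of c d] by auto

section \<open>Fractions and primary localizations\<close>

lemma frac_eq_zero_iff:
  assumes "a \<in> carrier R" "s \<in> carrier R - I"
  shows "frac R (carrier R - I) a s = \<zero>\<^bsub>localization_at R I\<^esub> \<longleftrightarrow> a \<in> loc_ker R I"
proof -
  interpret M: mult_submonoid R "carrier R - I" by (rule mult_submonoid_compl)
  have "\<one> \<in> carrier R - I"
    using one_notin by simp
  then show ?thesis
    using assms M.frac_eq_iff[of a s \<zero> \<one>]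
    by (simp add: localization_at_def M.localization_zero loc_ker_eq a_minus_def del: Diff_iff)
qed

lemma frac_pow:
  assumes "a \<in> carrier R" "s \<in> carrier R - I"
  shows "frac R (carrier R - I) a s [^]\<^bsub>localization_at R I\<^esub> (n::nat)
    = frac R (carrier R - I) (a [^] n) (s [^] n)"
proof -
  interpret M: mult_submonoid R "carrier R - I" by (rule mult_submonoid_compl)
  interpret L: cring "localization_at R I" by (rule cring_localization_at)
  show ?thesis
  proof (induction n)
    case 0
    then show ?case by (simp add: localization_at_def M.localization_one)
  next
    case (Suc n)
    have "s [^] n \<in> carrier R - I" using assms pow_notin by auto
    then show ?case
      using Suc assms M.localization_mult[of "a [^] n" "s [^] n" a s]
      by (simp add: localization_at_def)
  qed
qed

text \<open>Whether a fraction vanishes depends on its numerator alone, so the primary condition on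
  fractions becomes the same condition on numerators modulo the kernel.\<close>

lemma primary_localization_iff:
  "primary_ring (localization_at R I) \<longleftrightarrow> primary_ideal (loc_ker R I) R"
proof -
  interpret M: mult_submonoid R "carrier R - I" by (rule mult_submonoid_compl)
  let ?L = "localization_at R I" and ?K = "loc_ker R I"
  let ?f = "frac R (carrier R - I)"
  interpret L: cring ?L by (rule cring_localization_at)
  have mult: "?f a s \<otimes>\<^bsub>?L\<^esub> ?f b t = ?f (a \<otimes> b) (s \<otimes> t)"
    if "a \<in> carrier R" "s \<in> carrier R - I" "b \<in> carrier R" "t \<in> carrier R - I" for a s b t
    using M.localization_mult[OF that] by (simp add: localization_at_def)
  have carr: "carrier ?L = {?f a s |a s. a \<in> carrier R \<and> s \<in> carrier R - I}"
    using M.carrier_localization by (simp add: localization_at_def)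
  have st: "s \<otimes> t \<in> carrier R - I" if "s \<in> carrier R - I" "t \<in> carrier R - I" for s t
    using that I_prime by auto
  have one: "\<one> \<in> carrier R - I"
    using one_notin by simp
  have sn: "s [^] (n::nat) \<in> carrier R - I" if "s \<in> carrier R - I" for s n
    using that pow_notin by auto
  have "\<one> \<notin> ?K" using loc_ker_subset one by blast
  then have "?f \<one> \<one> \<noteq> \<zero>\<^bsub>?L\<^esub>"
    using frac_eq_zero_iff[OF one_closed one] by blast
  then have proper: "{\<zero>\<^bsub>?L\<^esub>} \<noteq> carrier ?L" "?K \<noteq> carrier R"
    using carr one \<open>\<one> \<notin> ?K\<close> by blast+
  have "(\<forall>x\<in>carrier ?L. \<forall>y\<in>carrier ?L. x \<otimes>\<^bsub>?L\<^esub> y = \<zero>\<^bsub>?L\<^esub> \<longrightarrow>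
       x = \<zero>\<^bsub>?L\<^esub> \<or> (\<exists>n::nat. n \<ge> 1 \<and> y [^]\<^bsub>?L\<^esub> n = \<zero>\<^bsub>?L\<^esub>))
    \<longleftrightarrow> (\<forall>a\<in>carrier R. \<forall>s\<in>carrier R - I. \<forall>b\<in>carrier R. \<forall>t\<in>carrier R - I.
       ?f a s \<otimes>\<^bsub>?L\<^esub> ?f b t = \<zero>\<^bsub>?L\<^esub> \<longrightarrow>
       ?f a s = \<zero>\<^bsub>?L\<^esub> \<or> (\<exists>n::nat. n \<ge> 1 \<and> ?f b t [^]\<^bsub>?L\<^esub> n = \<zero>\<^bsub>?L\<^esub>))"
    unfolding carr by blast
  also have "\<dots> \<longleftrightarrow> (\<forall>a\<in>carrier R. \<forall>s\<in>carrier R - I. \<forall>b\<in>carrier R. \<forall>t\<in>carrier R - I.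
       a \<otimes> b \<in> ?K \<longrightarrow> a \<in> ?K \<or> (\<exists>n::nat. n \<ge> 1 \<and> b [^] n \<in> ?K))"
    by (intro ball_cong refl)
      (simp only: mult frac_pow frac_eq_zero_iff st sn m_closed nat_pow_closed)
  also have "\<dots> \<longleftrightarrow> (\<forall>a\<in>carrier R. \<forall>b\<in>carrier R.
       a \<otimes> b \<in> ?K \<longrightarrow> a \<in> ?K \<or> (\<exists>n::nat. n \<ge> 1 \<and> b [^] n \<in> ?K))"
    using one by blast
  finally show ?thesis
    using proper L.zeroideal ideal_loc_ker L.is_cring
    by (simp add: primary_ring_def primary_ideal_def)
qed

section \<open>Consequences of comaximality for the kernels\<close>

lemma primary_loc_ker_if_comaximal:
  assumes comax: "comaximal_annihilators"
  shows "primary_ideal (loc_ker R I) R"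
  unfolding primary_ideal_def
proof (intro conjI ballI impI)
  show "ideal (loc_ker R I) R" by (rule ideal_loc_ker)
  show "loc_ker R I \<noteq> carrier R"
    using loc_ker_subset I_notcarr a_subset by blast
  fix a b assume ab: "a \<in> carrier R" "b \<in> carrier R" "a \<otimes> b \<in> loc_ker R I"
  then obtain s where s: "s \<in> carrier R" "s \<notin> I" "s \<otimes> (a \<otimes> b) = \<zero>"
    by (auto simp: mem_loc_ker_iff)
  \<comment> \<open>Comaximality requires a product equal to \<zero>, so the denominator
    \<open>s\<close> is absorbed into \<open>a\<close>. If \<open>c\<close> lies outside the prime,
    then \<open>c \<otimes> s\<close> witnesses that \<open>a\<close> is in the kernel; otherwise
    \<open>d\<close> witnesses it for \<open>b [^] n\<close>.\<close>
  then have sab: "s \<otimes> a \<in> carrier R" "(s \<otimes> a) \<otimes> b = \<zero>"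
    using ab by (simp_all add: m_assoc)
  obtain n c d where n: "n \<ge> 1" and cd: "c \<in> carrier R" "d \<in> carrier R" "c \<oplus> d = \<one>"
    "c \<otimes> (s \<otimes> a) = \<zero>" "d \<otimes> b [^] (n::nat) = \<zero>"
    using comaximal_annihilatorsE[OF comax sab(1) ab(2) sab(2)] .
  show "a \<in> loc_ker R I \<or> (\<exists>n::nat. n \<ge> 1 \<and> b [^] n \<in> loc_ker R I)"
  proof (cases "c \<in> I")
    case True
    then have "d \<notin> I" by (rule add_eq_one_notin[OF cd(3)])
    then have "b [^] n \<in> loc_ker R I"
      using cd ab by (auto simp: mem_loc_ker_iff)
    with n show ?thesis by blast
  next
    case False
    then have "c \<otimes> s \<notin> I" using I_prime cd s by blast
    moreover have "(c \<otimes> s) \<otimes> a = \<zero>" using cd s ab by (simp add: m_assoc)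
    ultimately have "a \<in> loc_ker R I"
      using cd s ab by (auto simp: mem_loc_ker_iff intro!: bexI[of _ "c \<otimes> s"])
    then show ?thesis ..
  qed
qed

text \<open>Comaximality is applied to \<open>a\<close> and a denominator \<open>s\<close> that
  annihilates it. Since \<open>s [^] n\<close> still lies outside the prime, the part
  \<open>d\<close> that annihilates it belongs to the kernel.\<close>

lemma loc_ker_comaximalE:
  assumes "comaximal_annihilators" "a \<in> loc_ker R I"
  obtains c d where "c \<in> carrier R" "d \<in> loc_ker R I" "c \<oplus> d = \<one>" "c \<otimes> a = \<zero>"
proof -
  obtain s where s: "a \<in> carrier R" "s \<in> carrier R" "s \<notin> I" "s \<otimes> a = \<zero>"
    using assms(2) by (auto simp: mem_loc_ker_iff)
  then have "a \<otimes> s = \<zero>" by (simp add: m_comm)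
  then obtain n c d where "c \<in> carrier R" and d: "d \<in> carrier R" and "c \<oplus> d = \<one>"
    "c \<otimes> a = \<zero>" and ds: "d \<otimes> s [^] (n::nat) = \<zero>"
    using comaximal_annihilatorsE[OF assms(1) s(1,2)] by metis
  moreover have "s [^] n \<otimes> d = \<zero>"
    using d ds s by (simp add: m_comm)
  then have "d \<in> loc_ker R I"
    using pow_notin[OF s(2,3), of n] s d by (auto simp: mem_loc_ker_iff)
  ultimately show ?thesis using that by blast
qed

lemma pure_loc_ker_if_comaximal:
  assumes "comaximal_annihilators"
  shows "pure_ideal (loc_ker R I) R"
  unfolding pure_ideal_def
proof (intro conjI ballI)
  fix a assume a: "a \<in> loc_ker R I"
  then obtain c d where cd: "c \<in> carrier R" "d \<in> loc_ker R I" "c \<oplus> d = \<one>" "c \<otimes> a = \<zero>"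
    using loc_ker_comaximalE[OF assms] by blast
  have carr: "a \<in> carrier R" "d \<in> carrier R"
    using a cd by (auto simp: mem_loc_ker_iff)
  \<comment> \<open>The kernel element \<open>d\<close> is the purity witness, because
    \<open>\<one> \<ominus> d\<close> is the annihilating part \<open>c\<close>.\<close>
  have "c = (c \<oplus> d) \<ominus> d" using cd(1) carr by algebra
  then have "a \<otimes> (\<one> \<ominus> d) = \<zero>"
    using cd carr by (simp add: m_comm)
  with cd(2) show "\<exists>b\<in>loc_ker R I. a \<otimes> (\<one> \<ominus> b) = \<zero>" by blast
qed (rule ideal_loc_ker)

text \<open>A smaller prime ideal admits more denominators.\<close>

lemma loc_ker_antimono:
  assumes "primeideal Q R" "I \<subseteq> Q"
  shows "loc_ker R Q \<subseteq> loc_ker R I"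
proof
  fix a assume "a \<in> loc_ker R Q"
  then show "a \<in> loc_ker R I"
    unfolding mem_loc_ker_iff primeideal.mem_loc_ker_iff[OF assms(1)] using assms(2) by blast
qed

lemma loc_ker_eq_if_comaximal:
  assumes "comaximal_annihilators" "primeideal Q R" "I \<subseteq> Q"
  shows "loc_ker R I = loc_ker R Q"
proof
  interpret Q: primeideal Q R by fact
  show "loc_ker R I \<subseteq> loc_ker R Q"
  proof
    fix a assume a: "a \<in> loc_ker R I"
    then obtain c d where cd: "c \<in> carrier R" "d \<in> loc_ker R I" "c \<oplus> d = \<one>" "c \<otimes> a = \<zero>"
      using loc_ker_comaximalE[OF assms(1)] by blast
    \<comment> \<open>The kernel part \<open>d\<close> falls into the larger prime \<open>Q\<close>,
      which forces \<open>c\<close> out of it and makes \<open>c\<close> a valid denominator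
      there.\<close>
    have "d \<in> Q" using cd(2) loc_ker_subset assms(3) by blast
    then have "c \<notin> Q" using Q.add_eq_one_notin[of c d] cd(3) by blast
    then show "a \<in> loc_ker R Q"
      using a cd by (auto simp: Q.mem_loc_ker_iff mem_loc_ker_iff)
  qed
qed (rule loc_ker_antimono[OF assms(2,3)])

end


section \<open>The converse implications\<close>

context cring
begin

lemma comaximal_if_primary_loc_ker:
  assumes "\<And>M. maximalideal M R \<Longrightarrow> primary_ideal (loc_ker R M) R"
  shows "comaximal_annihilators"
  unfolding comaximal_annihilators_def
proof (intro ballI impI)
  fix a b assume ab: "a \<in> carrier R" "b \<in> carrier R" "a \<otimes> b = \<zero>"
  show "\<exists>n::nat. n \<ge> 1 \<and> annihilator R a <+> annihilator R (b [^] n) = carrier R"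
  proof (rule comaximal_if_no_maximalideal[OF ab(1,2)])
    fix M assume M: "maximalideal M R" "annihilator R a \<subseteq> M"
      and bM: "\<And>n::nat. annihilator R (b [^] n) \<subseteq> M"
    interpret M: primeideal M R by (rule maximalideal_prime[OF M(1)])
    have "a \<otimes> b \<in> loc_ker R M"
      using ab(3) additive_subgroup.zero_closed[OF ideal.axioms(1)[OF M.ideal_loc_ker]] by simp
    then have "a \<in> loc_ker R M \<or> (\<exists>n::nat. n \<ge> 1 \<and> b [^] n \<in> loc_ker R M)"
      using assms[OF M(1)] ab(1,2) by (simp add: primary_ideal_def)
    \<comment> \<open>All annihilators in question lie in \<open>M\<close>, so neither
      \<open>a\<close> nor any power of \<open>b\<close> belongs to the kernel.\<close>
    then show False
      using ab(1,2) M(2) bM by (auto simp: M.loc_ker_iff_annihilator)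
  qed
qed

text \<open>The hypothesis is a common consequence of (vi) and (vii), so both converses reduce to
  this one argument.\<close>

lemma comaximal_if_loc_ker_minimal:
  assumes "\<And>P M a. \<lbrakk>minimal_primeideal P R; maximalideal M R; P \<subseteq> M; a \<in> loc_ker R P\<rbrakk>
    \<Longrightarrow> a \<in> loc_ker R M"
  shows "comaximal_annihilators"
  unfolding comaximal_annihilators_def
proof (intro ballI impI)
  fix a b assume ab: "a \<in> carrier R" "b \<in> carrier R" "a \<otimes> b = \<zero>"
  show "\<exists>n::nat. n \<ge> 1 \<and> annihilator R a <+> annihilator R (b [^] n) = carrier R"
  proof (rule comaximal_if_no_minimal_primeideal[OF ab(1,2)])
    fix P M assume PM: "minimal_primeideal P R" "maximalideal M R" "P \<subseteq> M" "b \<notin> P"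
      "annihilator R a \<subseteq> M"
    interpret P: primeideal P R using PM(1) by (simp add: minimal_primeideal_def)
    interpret M: primeideal M R by (rule maximalideal_prime[OF PM(2)])
    \<comment> \<open>Since \<open>b\<close> is outside \<open>P\<close>, it is itself a denominator
      annihilating \<open>a\<close>.\<close>
    have "b \<otimes> a = \<zero>" using ab by (simp add: m_comm)
    then have "a \<in> loc_ker R P"
      using ab PM(4) by (auto simp: P.mem_loc_ker_iff)
    then have "a \<in> loc_ker R M"
      by (rule assms[OF PM(1-3)])
    then show False
      using M.loc_ker_iff_annihilator[OF ab(1)] PM(5) by blast
  qed
qed

text \<open>A purity witness \<open>c\<close> for \<open>a\<close> lies in \<open>P\<close> and
  hence in \<open>M\<close>. So \<open>\<one> \<ominus> c\<close> lies outside \<open>M\<close> and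
  annihilates \<open>a\<close>, which moves \<open>a\<close> into the kernel at
  \<open>M\<close>.\<close>

lemma comaximal_if_pure_loc_ker:
  assumes "\<And>P. minimal_primeideal P R \<Longrightarrow> pure_ideal (loc_ker R P) R"
  shows "comaximal_annihilators"
proof (rule comaximal_if_loc_ker_minimal)
  fix P M a
  assume PM: "minimal_primeideal P R" "maximalideal M R" "P \<subseteq> M" and a: "a \<in> loc_ker R P"
  interpret P: primeideal P R using PM(1) by (simp add: minimal_primeideal_def)
  interpret M: primeideal M R by (rule maximalideal_prime[OF PM(2)])
  obtain c where c: "c \<in> loc_ker R P" "a \<otimes> (\<one> \<ominus> c) = \<zero>"
    using assms[OF PM(1)] a by (auto simp: pure_ideal_def)
  have carr: "a \<in> carrier R" "c \<in> carrier R"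
    using a c(1) by (auto simp: P.mem_loc_ker_iff)
  have "c \<oplus> (\<one> \<ominus> c) = \<one>" using carr(2) by algebra
  moreover have "c \<in> M" using c(1) P.loc_ker_subset PM(3) by blast
  ultimately have "\<one> \<ominus> c \<notin> M"
    by (rule M.add_eq_one_notin)
  moreover have "\<one> \<ominus> c \<in> carrier R" "(\<one> \<ominus> c) \<otimes> a = \<zero>"
    using c(2) carr m_comm[of a "\<one> \<ominus> c"] by simp_all
  ultimately show "a \<in> loc_ker R M"
    unfolding M.mem_loc_ker_iff using carr(1) by blast
qed

end

theorem theorem4p7:
  fixes R :: "('a, 'b) ring_scheme" (structure)
  assumes "cring R"
  shows
    "(mid_ring R \<longleftrightarrow>
        (\<forall>a\<in>carrier R. \<forall>b\<in>carrier R. a \<otimes> b = \<zero> \<longrightarrow>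
           (\<exists>n::nat. n \<ge> 1 \<and> annihilator R a <+> annihilator R (b [^] n) = carrier R)))
   \<and> (mid_ring R \<longleftrightarrow> (\<forall>P. primeideal P R \<longrightarrow> primary_ring (localization_at R P)))
   \<and> (mid_ring R \<longleftrightarrow> (\<forall>M. maximalideal M R \<longrightarrow> primary_ring (localization_at R M)))
   \<and> (mid_ring R \<longleftrightarrow> (\<forall>P. primeideal P R \<longrightarrow> pure_ideal (loc_ker R P) R))
   \<and> (mid_ring R \<longleftrightarrow> (\<forall>P. minimal_primeideal P R \<longrightarrow> pure_ideal (loc_ker R P) R))
   \<and> (mid_ring R \<longleftrightarrow>
        (\<forall>P Q. primeideal P R \<longrightarrow> primeideal Q R \<longrightarrow> P \<subseteq> Q \<longrightarrow> loc_ker R P = loc_ker R Q))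
   \<and> (mid_ring R \<longleftrightarrow> (\<forall>P. primeideal P R \<longrightarrow> primary_ideal (loc_ker R P) R))
   \<and> (mid_ring R \<longleftrightarrow> (\<forall>M. maximalideal M R \<longrightarrow> primary_ideal (loc_ker R M) R))"
proof -
  interpret cring R by fact
  note mid = mid_ring_iff_comaximal_annihilators
  have maxD: "primeideal M R" if "maximalideal M R" for M
    using that by (rule maximalideal_prime)
  have minD: "primeideal P R" if "minimal_primeideal P R" for P
    using that by (simp add: minimal_primeideal_def)
  \<comment> \<open>Comaximality gives the statement for all primes, which include the maximal
    ideals; the maximal case already returns comaximality. Minimal primes play the same part for
    purity below.\<close>
  have viii: "mid_ring R \<longleftrightarrow> (\<forall>P. primeideal P R \<longrightarrow> primary_ideal (loc_ker R P) R)"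
    unfolding mid
    by (blast intro: primeideal.primary_loc_ker_if_comaximal comaximal_if_primary_loc_ker maxD)
  have ix: "mid_ring R \<longleftrightarrow> (\<forall>M. maximalideal M R \<longrightarrow> primary_ideal (loc_ker R M) R)"
    unfolding mid
    by (blast intro: primeideal.primary_loc_ker_if_comaximal comaximal_if_primary_loc_ker maxD)
  have iii: "mid_ring R \<longleftrightarrow> (\<forall>P. primeideal P R \<longrightarrow> primary_ring (localization_at R P))"
    unfolding viii using primeideal.primary_localization_iff by blast
  have iv: "mid_ring R \<longleftrightarrow> (\<forall>M. maximalideal M R \<longrightarrow> primary_ring (localization_at R M))"
    unfolding ix using primeideal.primary_localization_iff[OF maxD] by blast
  have v: "mid_ring R \<longleftrightarrow> (\<forall>P. primeideal P R \<longrightarrow> pure_ideal (loc_ker R P) R)"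
    unfolding mid
    by (blast intro: primeideal.pure_loc_ker_if_comaximal comaximal_if_pure_loc_ker minD)
  have vi: "mid_ring R \<longleftrightarrow> (\<forall>P. minimal_primeideal P R \<longrightarrow> pure_ideal (loc_ker R P) R)"
    unfolding mid
    by (blast intro: primeideal.pure_loc_ker_if_comaximal comaximal_if_pure_loc_ker minD)
  have vii: "mid_ring R \<longleftrightarrow>
      (\<forall>P Q. primeideal P R \<longrightarrow> primeideal Q R \<longrightarrow> P \<subseteq> Q \<longrightarrow> loc_ker R P = loc_ker R Q)"
    (is "_ \<longleftrightarrow> ?vii")
  proof
    assume "mid_ring R"
    then show ?vii
      unfolding mid using primeideal.loc_ker_eq_if_comaximal by blast
  next
    assume vii: ?vii
    show "mid_ring R"
      unfolding mid
    proof (rule comaximal_if_loc_ker_minimal)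
      fix P M a
      assume "minimal_primeideal P R" "maximalideal M R" "P \<subseteq> M" "a \<in> loc_ker R P"
      moreover from this have "loc_ker R P = loc_ker R M"
        using vii minD maxD by blast
      ultimately show "a \<in> loc_ker R M" by simp
    qed
  qed
  show ?thesis
    by (intro conjI mid[unfolded comaximal_annihilators_def] iii iv v vi vii viii ix)
qed

end
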